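(* For every convex body $K \subset \mathbb{R}^2$ there exists a constant $C_K > 0$ such that for all $n > C_K$, $$\mathbb{E}|XX'|^n \le \mathbb{E}|XY|^n \le \mathbb{E}|YY'|^n,$$ where $X, X'$ are uniformly distributed random points in $K$ and $Y, Y'$ are uniformly distributed random points on $\partial K$, all independent.
   Context: A convex body is a convex compact set with non-empty interior. "Uniform in $K$" is with respect to Lebesgue measure; "uniform on $\partial K$" is with respect to arc length. $|AB|$ denotes the Euclidean distance between points $A$ and $B$. *)

theory Defs
  imports "HOL-Probability.Probability"
begin

definition convex_body :: "'a::euclidean_space set \<Rightarrow> bool" where
  "convex_body K \<longleftrightarrow> convex K \<and> compact K \<and> interior K \<noteq> {}"

(* Supremum of the lengths of inscribed polygons: the polygon with k edges has vertices
   g (t 0), ..., g (t k). *)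
definition curve_length :: "(real \<Rightarrow> 'a::metric_space) \<Rightarrow> real \<Rightarrow> real \<Rightarrow> ennreal" where
  "curve_length g a b =
     (SUP (k, t) \<in> {(k::nat, t::nat \<Rightarrow> real). mono t \<and> range t \<subseteq> {a..b}}.
        \<Sum>i<k. ennreal (dist (g (t i)) (g (t (Suc i)))))"

definition arc_length_parametrization ::
  "(real \<Rightarrow> 'a::metric_space) \<Rightarrow> real \<Rightarrow> 'a set \<Rightarrow> bool" where
  "arc_length_parametrization g L S \<longleftrightarrow>
     0 < L \<and> continuous_on {0..L} g \<and> g ` {0..L} = S \<and> g 0 = g L \<and> inj_on g {0..<L} \<and>
     (\<forall>s t. 0 \<le> s \<and> s \<le> t \<and> t \<le> L \<longrightarrow> curve_length g s t = ennreal (t - s))"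

(* The measure carried by S that gives each arc of S its length. It does not depend on the
   choice of the parametrization. *)
definition arc_length_measure_on :: "'a::metric_space set \<Rightarrow> 'a measure \<Rightarrow> bool" where
  "arc_length_measure_on S \<mu> \<longleftrightarrow>
     (\<exists>g L. arc_length_parametrization g L S \<and> \<mu> = distr (lebesgue_on {0..L}) borel g)"

definition uniform_in :: "'s measure \<Rightarrow> 'a::euclidean_space set \<Rightarrow> ('s \<Rightarrow> 'a) \<Rightarrow> bool" where
  "uniform_in M K X \<longleftrightarrow>
     X \<in> borel_measurable M \<and> distr M borel X = uniform_measure lborel K"

(* S is meant to be a rectifiable closed Jordan curve, such as the boundary of a planar
   convex body; for other sets S the predicate is false. *)
definition uniform_on_curve :: "'s measure \<Rightarrow> 'a::metric_space set \<Rightarrow> ('s \<Rightarrow> 'a) \<Rightarrow> bool" where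
  "uniform_on_curve M S Y \<longleftrightarrow>
     Y \<in> borel_measurable M \<and>
     (\<exists>\<mu>. arc_length_measure_on S \<mu> \<and> distr M borel Y = uniform_measure \<mu> S)"

end

(* For q in K, the map (s, t) \<mapsto> q + t (g s - q), with g the arc length parametrization of the
   boundary, sweeps K and distorts area by a factor at most diam K; the factor t^n in
   |q + t (g s - q) - q|^n integrates to 1/(n+1). Hence E|X - q|^n is at most a constant
   times |\<partial>K| / (n area K) times E|Y - q|^n, uniformly in q. For n large the product is
   at most E|Y - q|^n, and averaging over q = X and q = Y gives the two inequalities.
   The constant must not depend on the parametrization, so the length is bounded in terms
   of K: the boundary is a Lipschitz function of the angle seen from an interior point. *)
theory Submission
  imports Defs
begin

section \<open>Polar description of the frontier of a convex set\<close>

lemma norm_scaleR_sgn: "norm a *\<^sub>R sgn a = a" for a :: "'a::real_normed_vector"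
  by (cases "a = 0") (auto simp: sgn_div_norm)

text \<open>A segment from \<open>x\<close> to a point of the ball around \<open>c\<close> consists
  of interior points, except possibly for \<open>x\<close>. A frontier point \<open>y\<close> nearer
  to \<open>c\<close> must avoid all these segments, so its direction has to differ from that of
  \<open>x\<close> in proportion to the gap in distance. Exchanging \<open>x\<close> and
  \<open>y\<close> makes the distance from \<open>c\<close> a Lipschitz function of the
  direction.\<close>

lemma frontier_norm_diff_le:
  fixes K :: "'a::euclidean_space set"
  assumes "convex K" "closed K" "ball c r \<subseteq> K" "0 < r" "K \<subseteq> cball c D"
    and x: "x \<in> frontier K" and y: "y \<in> frontier K"
  shows "norm (x - c) - norm (y - c) \<le> D\<^sup>2 / r * norm (sgn (x - c) - sgn (y - c))"
proof (cases "norm (y - c) < norm (x - c)")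
  case True
  define a where "a = x - c"
  define b where "b = y - c"
  \<comment> \<open>Scaling by \<open>l\<close> brings \<open>a\<close> to the length of
    \<open>b\<close>, so \<open>l *\<^sub>R a\<close> and \<open>b\<close> differ in direction
    only.\<close>
  define l where "l = norm b / norm a"
  (* w is chosen so that y is the convex combination of x and c + w; if c + w were in the
     ball, y would be an interior point. *)
  define w where "w = (norm b / (1 - l)) *\<^sub>R (sgn b - sgn a)"
  have ab: "norm b < norm a" "0 < norm a" using True by (auto simp: a_def b_def intro: le_less_trans[OF norm_ge_zero])
  have l: "0 \<le> l" "l < 1" using ab by (auto simp: l_def)
  have xK: "x \<in> K" "y \<in> K" using x y \<open>closed K\<close> by (auto simp: frontier_def)
  have D: "norm a \<le> D" "norm b \<le> D" using xK assms(5) by (auto simp: a_def b_def dist_norm norm_minus_commute)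
  have "r \<le> norm w"
  proof (rule ccontr)
    assume "\<not> r \<le> norm w"
    then have "c + w \<in> ball c r" by (simp add: dist_norm)
    then have int: "c + w \<in> interior K" using assms(3) interior_maximal by blast
    have "l *\<^sub>R a = norm b *\<^sub>R sgn a" using ab by (simp add: l_def sgn_div_norm field_simps)
    moreover have "norm b *\<^sub>R sgn b = b" by (rule norm_scaleR_sgn)
    moreover have "(1 - l) *\<^sub>R w = norm b *\<^sub>R (sgn b - sgn a)" using l by (simp add: w_def)
    ultimately have "x - (1 - l) *\<^sub>R (x - (c + w)) = y"
      by (simp add: a_def b_def algebra_simps)
    moreover have "x - (1 - l) *\<^sub>R (x - (c + w)) \<in> interior K"
      by (rule mem_interior_convex_shrink[OF \<open>convex K\<close> int xK(1)]) (use l in auto)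
    ultimately show False using y by (auto simp: frontier_def)
  qed
  also have "norm w = norm b * norm a * norm (sgn a - sgn b) / (norm a - norm b)"
  proof -
    have "1 - l = (norm a - norm b) / norm a" using ab by (simp add: l_def diff_divide_distrib)
    then show ?thesis using ab unfolding w_def norm_scaleR by (simp add: norm_minus_commute)
  qed
  finally have "(norm a - norm b) * r \<le> norm b * norm a * norm (sgn a - sgn b)"
    using ab by (simp add: field_simps)
  also have "\<dots> \<le> D * D * norm (sgn a - sgn b)"
    using D by (intro mult_right_mono mult_mono) (auto intro: order_trans[OF norm_ge_zero])
  finally show ?thesis using \<open>0 < r\<close> by (simp add: a_def b_def field_simps power2_eq_square)
next
  case False
  then show ?thesis using \<open>0 < r\<close>
    by (smt (verit) divide_nonneg_pos mult_nonneg_nonneg norm_ge_zero zero_le_power2)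
qed

text \<open>The displacement splits into a radial part, controlled by the previous lemma used in
  both orders, and a rotation at radius at most \<open>D\<close>.\<close>

lemma dist_frontier_le_sgn:
  fixes K :: "'a::euclidean_space set"
  assumes "convex K" "closed K" "ball c r \<subseteq> K" "0 < r" "K \<subseteq> cball c D"
    and x: "x \<in> frontier K" and y: "y \<in> frontier K"
  shows "dist x y \<le> (D + D\<^sup>2 / r) * norm (sgn (x - c) - sgn (y - c))"
proof -
  define a where "a = x - c"
  define b where "b = y - c"
  have "norm b \<le> D" using y assms(2,5) by (auto simp: frontier_def b_def dist_norm norm_minus_commute)
  have "a - b = (norm a - norm b) *\<^sub>R sgn a + norm b *\<^sub>R (sgn a - sgn b)"
    by (simp add: norm_scaleR_sgn algebra_simps)
  then have "norm (a - b) \<le> \<bar>norm a - norm b\<bar> * norm (sgn a) + norm b * norm (sgn a - sgn b)"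
    by (metis norm_triangle_ineq norm_scaleR abs_norm_cancel)
  also have "\<dots> \<le> \<bar>norm a - norm b\<bar> * 1 + D * norm (sgn a - sgn b)"
    using \<open>norm b \<le> D\<close> order_trans[OF norm_ge_zero \<open>norm b \<le> D\<close>]
    by (intro add_mono mult_mono) (auto simp: norm_sgn)
  also have "\<bar>norm a - norm b\<bar> \<le> D\<^sup>2 / r * norm (sgn a - sgn b)"
    using frontier_norm_diff_le[OF assms(1-5) x y] frontier_norm_diff_le[OF assms(1-5) y x]
    by (auto simp: a_def b_def norm_minus_commute abs_le_iff)
  finally show ?thesis by (simp add: a_def b_def dist_norm algebra_simps)
qed

section \<open>Arc length and angle\<close>

text \<open>Along an inscribed polygon the increments of a monotone \<open>\<theta>\<close> have
  constant sign, so the edge bounds telescope. Here \<open>\<theta>\<close> stands for the angle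
  along a curve.\<close>

lemma curve_length_le_monotone:
  fixes g :: "real \<Rightarrow> 'a::metric_space"
  assumes "mono_on {a..b} \<theta>" "0 \<le> C" "a \<le> b"
    and "\<And>s t. s \<in> {a..b} \<Longrightarrow> t \<in> {a..b} \<Longrightarrow> dist (g s) (g t) \<le> C * \<bar>\<theta> s - \<theta> t\<bar>"
  shows "curve_length g a b \<le> ennreal (C * (\<theta> b - \<theta> a))"
  unfolding curve_length_def
proof (rule SUP_least, clarify)
  fix k :: nat and t :: "nat \<Rightarrow> real"
  assume t: "mono t" "range t \<subseteq> {a..b}"
  have m: "\<theta> u \<le> \<theta> v" if "u \<in> {a..b}" "v \<in> {a..b}" "u \<le> v" for u v
    using assms(1) that by (auto simp: monotone_on_def)
  have tab: "t i \<in> {a..b}" for i using t(2) by (meson rangeI subsetD)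
  have "(\<Sum>i<k. ennreal (dist (g (t i)) (g (t (Suc i)))))
      = ennreal (\<Sum>i<k. dist (g (t i)) (g (t (Suc i))))" by (simp add: sum_ennreal)
  also have "\<dots> \<le> ennreal (\<Sum>i<k. C * (\<theta> (t (Suc i)) - \<theta> (t i)))"
  proof (intro ennreal_leI sum_mono)
    fix i
    have "\<theta> (t i) \<le> \<theta> (t (Suc i))" using m[OF tab tab] t(1) by (simp add: mono_iff_le_Suc)
    then show "dist (g (t i)) (g (t (Suc i))) \<le> C * (\<theta> (t (Suc i)) - \<theta> (t i))"
      using assms(4)[OF tab[of i] tab[of "Suc i"]] by (simp add: abs_if split: if_splits)
  qed
  also have "(\<Sum>i<k. C * (\<theta> (t (Suc i)) - \<theta> (t i))) = C * (\<theta> (t k) - \<theta> (t 0))"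
    using sum_lessThan_telescope[of "\<lambda>i. \<theta> (t i)" k] by (simp only: sum_distrib_left[symmetric])
  also have "\<dots> \<le> C * (\<theta> b - \<theta> a)"
    using m[OF tab[of k], of b] m[OF _ tab[of 0], of a] tab[of k] tab[of 0] \<open>a \<le> b\<close> \<open>0 \<le> C\<close>
    by (intro mult_left_mono) auto
  finally show "(\<Sum>i<k. ennreal (dist (g (t i)) (g (t (Suc i))))) \<le> ennreal (C * (\<theta> b - \<theta> a))"
    by (simp add: ennreal_leI)
qed

text \<open>A chord is an inscribed polygon with a single edge, hence no longer than its
  arc.\<close>

lemma arc_length_parametrization_dist_le:
  assumes g: "arc_length_parametrization g L S" and st: "s \<in> {0..L}" "t \<in> {0..L}"
  shows "dist (g s) (g t) \<le> \<bar>s - t\<bar>"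
proof -
  have *: "dist (g s) (g t) \<le> t - s" if "0 \<le> s" "s \<le> t" "t \<le> L" for s t
  proof -
    define p where "p = (\<lambda>i::nat. if i = 0 then s else t)"
    have p: "mono p" "range p \<subseteq> {s..t}" using that by (auto simp: p_def mono_def)
    have "(\<Sum>i<1. ennreal (dist (g (p i)) (g (p (Suc i))))) \<le> curve_length g s t"
      unfolding curve_length_def
      by (rule SUP_upper2[of "(1, p)"]) (use p in auto)
    also have "\<dots> = ennreal (t - s)"
      using g that by (simp add: arc_length_parametrization_def)
    finally show ?thesis using that by (simp add: p_def)
  qed
  show ?thesis using *[of s t] *[of t s] st by (cases "s \<le> t") (auto simp: dist_commute)
qed

lemma norm_exp_ii_diff_le:
  fixes a b :: real
  shows "norm (exp (\<i> * a) - exp (\<i> * b)) \<le> \<bar>a - b\<bar>"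
proof -
  have "exp (\<i> * a) - exp (\<i> * b) = exp (\<i> * b) * (exp (\<i> * of_real (a - b)) - 1)"
    by (simp add: exp_diff algebra_simps)
  then have "norm (exp (\<i> * a) - exp (\<i> * b)) = 2 * \<bar>sin ((a - b) / 2)\<bar>"
    by (simp only: norm_mult dist_exp_i_1 norm_exp_i_times mult_1)
  also have "\<dots> \<le> \<bar>a - b\<bar>" using abs_sin_x_le_abs_x[of "(a - b)/2"] by simp
  finally show ?thesis by simp
qed

text \<open>Seen from \<open>c\<close>, the curve has a continuous angle. Injectivity of
  \<open>g\<close> makes the angle monotone with total change below a full turn, and the frontier is
  Lipschitz in the angle; so its length is at most the Lipschitz constant times
  \<open>2 * pi\<close>, whatever the parametrization.\<close>

lemma arc_length_frontier_bound:
  fixes K :: "(real ^ 2) set"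
  assumes K: "convex K" "closed K" "ball c r \<subseteq> K" "0 < r" "K \<subseteq> cball c D"
    and g: "arc_length_parametrization g L (frontier K)"
  shows "L \<le> (D + D\<^sup>2 / r) * (2 * pi)"
proof -
  define C where "C = D + D\<^sup>2 / r"
  \<comment> \<open>\<open>J\<close> identifies the plane isometrically with the complex numbers,
    where a continuous logarithm supplies the angle as its imaginary part.\<close>
  define J where "J = (\<lambda>v :: real^2. Complex (v $ 1) (v $ 2))"
  have normJ: "norm (J v) = norm v" for v
    by (simp add: J_def cmod_def norm_vec_def L2_set_def UNIV_2)
  have J_diff: "J u - J v = J (u - v)" for u v by (simp add: J_def complex_eq_iff)
  have J_scale: "J (a *\<^sub>R v) = a *\<^sub>R J v" for a v by (simp add: J_def complex_eq_iff)
  have sgnJ: "J (sgn v) = sgn (J v)" for v by (simp add: sgn_div_norm J_scale normJ)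
  have contJ: "continuous_on UNIV J"
    unfolding J_def by (auto simp: Complex_eq intro!: continuous_intros)
  have gK: "g s \<in> frontier K" if "s \<in> {0..L}" for s
    using g that by (auto simp: arc_length_parametrization_def)
  have c: "c \<in> interior K"
    using K(3,4) by (meson centre_in_ball interior_maximal open_ball subsetD)
  then have ne: "g s \<noteq> c" if "s \<in> {0..L}" for s
    using gK[OF that] by (auto simp: frontier_def)
  have "D \<ge> 0" using c K(5) interior_subset by fastforce
  then have "C \<ge> 0" using K(4) by (simp add: C_def)
  define f where "f = (\<lambda>s. J (g s - c))"
  have "continuous_on {0..L} f"
    unfolding f_def using g
    by (auto simp: arc_length_parametrization_def intro!: continuous_intros continuous_on_compose2[OF contJ])
  moreover have "f s \<noteq> 0" if "s \<in> {0..L}" for s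
    using ne[OF that] normJ[of "g s - c"] by (auto simp: f_def)
  moreover have "contractible {0..L}" by (simp add: convex_imp_contractible)
  ultimately obtain h where h: "continuous_on {0..L} h" "\<And>s. s \<in> {0..L} \<Longrightarrow> f s = exp (h s)"
    using continuous_logarithm_on_contractible by metis
  define \<theta> where "\<theta> = (\<lambda>s. Im (h s))"
  have cont: "continuous_on {0..L} \<theta>" unfolding \<theta>_def by (intro continuous_intros h)
  have sgnf: "sgn (f s) = exp (\<i> * \<theta> s)" if "s \<in> {0..L}" for s
  proof -
    have "f s = exp (Re (h s)) * exp (\<i> * \<theta> s)"
      using h(2)[OF that] exp_eq_polar[of "h s"] by (simp add: \<theta>_def cis_conv_exp)
    then show ?thesis by (simp add: sgn_div_norm norm_mult scaleR_conv_of_real)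
  qed
  \<comment> \<open>Besides the Lipschitz bound this yields \<open>period\<close> below: equal
    directions force equal points, hence equal parameters in \<open>{0..<L}\<close>.\<close>
  have dist: "dist (g s) (g t) \<le> C * norm (exp (\<i> * \<theta> s) - exp (\<i> * \<theta> t))"
    if "s \<in> {0..L}" "t \<in> {0..L}" for s t
    using dist_frontier_le_sgn[OF K gK gK, OF that] that sgnf[symmetric]
    by (simp add: C_def f_def sgnJ[symmetric] J_diff normJ)
  have Lip: "dist (g s) (g t) \<le> C * \<bar>\<theta> s - \<theta> t\<bar>" if "s \<in> {0..L}" "t \<in> {0..L}" for s t
    using dist[OF that] norm_exp_ii_diff_le[of "\<theta> s" "\<theta> t"] \<open>C \<ge> 0\<close>
    by (meson order_trans mult_left_mono)
  have inj_g: "inj_on g {0..<L}" and "0 < L" using g by (auto simp: arc_length_parametrization_def)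
  have period: "s = t" if "s \<in> {0..<L}" "t \<in> {0..<L}" "exp (\<i> * \<theta> s) = exp (\<i> * \<theta> t)" for s t
    using dist[of s t] that inj_g by (auto simp: inj_on_def)
  \<comment> \<open>Since \<open>g 0 = g L\<close>, injectivity fails on the closed interval; the
    bound is shown for every \<open>b < L\<close> and extended to \<open>L\<close> at the end by
    density.\<close>
  have "b \<le> C * (2 * pi)" if b: "0 < b" "b < L" for b
  proof -
    have contb: "continuous_on {0..b} \<theta>" using cont b by (auto intro: continuous_on_subset)
    have injb: "inj_on \<theta> {0..b}" using period b by (auto simp: inj_on_def)
    \<comment> \<open>After a full turn the intermediate value theorem would give an
      \<open>s\<close> with the same direction as at 0. Injectivity then forces
      \<open>s = 0\<close>, where the angle has not changed.\<close>
    have range: "\<bar>\<theta> b - \<theta> 0\<bar> < 2 * pi"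
    proof (rule ccontr)
      assume "\<not> ?thesis"
      then consider "\<theta> 0 \<le> \<theta> 0 + 2*pi" "\<theta> 0 + 2 * pi \<le> \<theta> b" | "\<theta> b \<le> \<theta> 0 - 2 * pi" "\<theta> 0 - 2*pi \<le> \<theta> 0"
        using pi_gt_zero by linarith
      then obtain s where s: "0 \<le> s" "s \<le> b" "\<theta> s = \<theta> 0 + 2*pi \<or> \<theta> s = \<theta> 0 - 2*pi"
        by (metis IVT' IVT2' contb b(1) less_imp_le)
      have "exp (\<i> * (2 * complex_of_real pi)) = 1"
        using exp_two_pi_i by (simp add: mult_ac)
      then have "exp (\<i> * \<theta> s) = exp (\<i> * \<theta> 0)"
        using s(3) by (auto simp: exp_add exp_diff ring_distribs)
      then have "s = 0" using period[of s 0] s b by auto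
      then show False using s(3) pi_gt_zero by auto
    qed
    have len: "curve_length g 0 b = ennreal b"
      using g b by (simp add: arc_length_parametrization_def)
    \<comment> \<open>A continuous injective function on an interval is strictly monotone; both
      cases remain because the orientation of \<open>g\<close> is not prescribed.\<close>
    have mono: "mono_on {0..b} \<theta> \<or> mono_on {0..b} (\<lambda>s. - \<theta> s)"
    proof -
      have "strict_mono_on {0..b} \<theta> \<or> strict_antimono_on {0..b} \<theta>"
        using injective_eq_monotone_map[OF _ contb] injb by (simp add: is_interval_cc)
      then show ?thesis
        by (auto simp: monotone_on_def le_less)
    qed
    then have "b \<le> C * \<bar>\<theta> b - \<theta> 0\<bar>"
    proof
      assume m: "mono_on {0..b} \<theta>"
      then have "\<theta> 0 \<le> \<theta> b" using b by (auto simp: monotone_on_def)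
      then show ?thesis
        using curve_length_le_monotone[OF m \<open>C \<ge> 0\<close>, of g] Lip b len \<open>C \<ge> 0\<close> by auto
    next
      assume m: "mono_on {0..b} (\<lambda>s. - \<theta> s)"
      then have "\<theta> b \<le> \<theta> 0" using b by (auto simp: monotone_on_def)
      then show ?thesis
        using curve_length_le_monotone[OF m \<open>C \<ge> 0\<close>, of g] Lip b len \<open>C \<ge> 0\<close>
        by (auto simp: abs_minus_commute)
    qed
    also have "\<dots> \<le> C * (2 * pi)" using range \<open>C \<ge> 0\<close> by (intro mult_left_mono) auto
    finally show ?thesis .
  qed
  then show ?thesis unfolding C_def[symmetric] using \<open>0 < L\<close>
    by (metis dense_ge_bounded dense_le_bounded)
qed

section \<open>Integration over a cone\<close>

text \<open>The parametrization \<open>F\<close> of the cone is only Lipschitz, so instead of a change of variables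
  \<open>\<phi> x\<close> is compared with the average of \<open>\<phi> \<circ> F\<close> over those parameters that \<open>F\<close> maps into
  \<open>cball x \<rho>\<close>. These have area at least \<open>\<rho>\<^sup>2 / (4 D)\<close>, while the points \<open>x\<close> that a single
  parameter serves have area at most \<open>\<pi> \<rho>\<^sup>2\<close>.\<close>

lemma nn_integral_cone_le:
  fixes \<gamma> :: "real \<Rightarrow> real ^ 2" and \<phi> :: "real ^ 2 \<Rightarrow> real"
  assumes \<gamma>: "1-lipschitz_on UNIV \<gamma>"
    and pos: "0 < L" "0 < D"
    and bnd: "\<And>s. dist (\<gamma> s) q \<le> D"
    and cone: "\<And>x. x \<in> K \<Longrightarrow> \<exists>s\<in>{0..L}. \<exists>t\<in>{0..1}. x = q + t *\<^sub>R (\<gamma> s - q)"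
    and K: "K \<in> sets borel"
    and \<phi>: "continuous_on UNIV \<phi>" "\<And>x. 0 \<le> \<phi> x"
  shows "(\<integral>\<^sup>+x\<in>K. \<phi> x \<partial>lborel) \<le>
    ennreal (4 * pi * D) * (\<integral>\<^sup>+s\<in>{0..L}. (\<integral>\<^sup>+t\<in>{0..1}. \<phi> (q + t *\<^sub>R (\<gamma> s - q)) \<partial>lborel) \<partial>lborel)"
proof -
  define F where "F = (\<lambda>p. q + snd p *\<^sub>R (\<gamma> (fst p) - q))"
  define Box where "Box = {0..L} \<times> {0..1::real}"
  define J where "J = (\<integral>\<^sup>+p\<in>Box. \<phi> (F p) \<partial>lborel)"
  have lip: "dist (\<gamma> s) (\<gamma> t) \<le> \<bar>s - t\<bar>" for s t
    using lipschitz_onD[OF \<gamma>] by (simp add: dist_real_def)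
  have cont_\<gamma>: "continuous_on UNIV \<gamma>" by (rule lipschitz_on_continuous_on[OF \<gamma>])
  have cont_F: "continuous_on UNIV F"
    unfolding F_def by (intro continuous_intros continuous_on_compose2[OF cont_\<gamma>]) auto
  have F_meas[measurable]: "F \<in> borel_measurable borel"
    using cont_F by (rule borel_measurable_continuous_onI)
  have \<phi>_meas[measurable]: "\<phi> \<in> borel_measurable borel"
    using \<phi>(1) by (rule borel_measurable_continuous_onI)
  have K_meas[measurable]: "K \<in> sets borel" by (rule K)
  have Times_meas: "{a..b} \<times> {c..d} \<in> sets (borel :: (real \<times> real) measure)" for a b c d
    by (intro borel_closed closed_Times) auto
  have emeasure_Times: "emeasure lborel ({a..b} \<times> {c..d}) = ennreal ((b - a) * (d - c))"
    if "a \<le> b" "c \<le> d" for a b c d :: real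
    unfolding lborel_prod[symmetric] using that
    by (subst lborel.emeasure_pair_measure_Times) (auto simp: ennreal_mult)
  have Box_meas[measurable]: "Box \<in> sets borel" unfolding Box_def by (rule Times_meas)
  have J_iter: "J = (\<integral>\<^sup>+s\<in>{0..L}. (\<integral>\<^sup>+t\<in>{0..1}. \<phi> (q + t *\<^sub>R (\<gamma> s - q)) \<partial>lborel) \<partial>lborel)"
  proof -
    have "J = (\<integral>\<^sup>+p. ennreal (\<phi> (F p)) * indicator Box p \<partial>(lborel \<Otimes>\<^sub>M lborel))"
      unfolding J_def lborel_prod ..
    also have "\<dots> = (\<integral>\<^sup>+s. \<integral>\<^sup>+t. ennreal (\<phi> (F (s, t))) * indicator Box (s, t) \<partial>lborel \<partial>lborel)"
      by (rule lborel.nn_integral_fst[symmetric]) (simp add: lborel_prod)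
    also have "\<dots> = (\<integral>\<^sup>+s\<in>{0..L}. (\<integral>\<^sup>+t\<in>{0..1}. \<phi> (q + t *\<^sub>R (\<gamma> s - q)) \<partial>lborel) \<partial>lborel)"
      by (intro nn_integral_cong) (auto simp: Box_def F_def indicator_times split: split_indicator)
    finally show ?thesis .
  qed
  \<comment> \<open>Replacing \<open>\<phi> x\<close> by values of \<open>\<phi>\<close> near
    \<open>x\<close> costs an error \<open>e\<close>, which is finally made arbitrarily
    small.\<close>
  have "(\<integral>\<^sup>+x\<in>K. \<phi> x \<partial>lborel) \<le> ennreal (4 * pi * D) * J + ennreal (4 * pi * D * L * e)" if "0 < e" for e
  proof -
    have "uniformly_continuous_on (cball q (D + 1)) \<phi>"
      by (intro compact_uniformly_continuous continuous_on_subset[OF \<phi>(1)]) auto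
    then obtain r where r: "0 < r"
      "\<And>x y. x \<in> cball q (D + 1) \<Longrightarrow> y \<in> cball q (D + 1) \<Longrightarrow> dist y x < r \<Longrightarrow> dist (\<phi> y) (\<phi> x) < e"
      unfolding uniformly_continuous_on_def using \<open>0 < e\<close> by metis
    \<comment> \<open>\<open>\<rho> < r\<close> serves uniform continuity; the other two bounds give
      \<open>a \<le> L\<close> and \<open>b \<le> 1\<close>, so an \<open>a\<close> by
      \<open>b\<close> rectangle fits into \<open>Box\<close>. The sides are chosen with
      \<open>a + b * D = \<rho>\<close>.\<close>
    define \<rho> where "\<rho> = min (r / 2) (min (2 * L) (2 * D))"
    define a where "a = \<rho> / 2"
    define b where "b = \<rho> / (2 * D)"
    have \<rho>: "0 < \<rho>" "\<rho> < r" using r pos by (auto simp: \<rho>_def)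
    have ab: "0 < a" "a \<le> L" "0 < b" "b \<le> 1"
      using \<rho> pos by (auto simp: a_def b_def field_simps) (auto simp: \<rho>_def)
    \<comment> \<open>Integrated over \<open>p\<close>, \<open>H x p\<close> dominates
      \<open>a * b * \<phi> x\<close> for \<open>x\<close> in \<open>K\<close>; integrated over
      \<open>x\<close>, it gives the area of a disc times \<open>\<phi> (F p) + e\<close> on
      \<open>Box\<close>. Fubini compares the two.\<close>
    define H where "H = (\<lambda>x p. indicator (cball (F p) \<rho>) x * (ennreal (\<phi> (F p) + e) * indicator Box p))"
    have F_cball: "F p \<in> cball q D" if "p \<in> Box" for p
      using that bnd[of "fst p"] mult_left_le_one_le[of "norm (\<gamma> (fst p) - q)" "snd p"]
      by (auto simp: F_def Box_def dist_norm intro: order_trans)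
    have point: "ennreal (a * b) * (ennreal (\<phi> x) * indicator K x) \<le> (\<integral>\<^sup>+p. H x p \<partial>lborel)" for x
    proof (cases "x \<in> K")
      case True
      then obtain s0 t0 where st: "s0 \<in> {0..L}" "t0 \<in> {0..1}" "x = q + t0 *\<^sub>R (\<gamma> s0 - q)"
        using cone by metis
      \<comment> \<open>The rectangle \<open>B\<close> contains \<open>(s0, t0)\<close>: it extends
        downwards from it where there is room and starts at 0 otherwise.\<close>
      define u where "u = (if s0 \<ge> a then s0 - a else 0)"
      define v where "v = (if t0 \<ge> b then t0 - b else 0)"
      define B where "B = {u..u+a} \<times> {v..v+b}"
      have B_meas: "B \<in> sets borel" unfolding B_def by (rule Times_meas)
      have B_Box: "B \<subseteq> Box" using st ab by (auto simp: B_def Box_def u_def v_def)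
      have xq: "x \<in> cball q D" using F_cball[of "(s0, t0)"] st by (simp add: F_def Box_def)
      have near: "dist (F p) x \<le> \<rho>" if "p \<in> B" for p
      proof -
        obtain s t where p: "p = (s, t)" by (cases p)
        have s: "\<bar>s - s0\<bar> \<le> a" and t: "\<bar>t - t0\<bar> \<le> b"
          using that st ab by (auto simp: p B_def u_def v_def split: if_splits)
        \<comment> \<open>The first term moves along the ray through \<open>\<gamma> s\<close>, at
          speed at most \<open>D\<close>; the second moves the end of the ray, at speed at most
          1.\<close>
        have "F p - x = (t - t0) *\<^sub>R (\<gamma> s - q) + t0 *\<^sub>R (\<gamma> s - \<gamma> s0)"
          by (simp add: F_def p st algebra_simps)
        then have "norm (F p - x) \<le> \<bar>t - t0\<bar> * norm (\<gamma> s - q) + \<bar>t0\<bar> * norm (\<gamma> s - \<gamma> s0)"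
          by (metis norm_triangle_ineq norm_scaleR)
        also have "\<dots> \<le> b * D + 1 * a"
          using s t st bnd[of s] lip[of s s0] ab by (intro add_mono mult_mono) (auto simp: dist_norm)
        also have "\<dots> = \<rho>" using pos by (simp add: a_def b_def)
        finally show ?thesis by (simp add: dist_norm)
      qed
      have "ennreal (a * b) * (ennreal (\<phi> x) * indicator K x) = (\<integral>\<^sup>+p. ennreal (\<phi> x) * indicator B p \<partial>lborel)"
        using True emeasure_Times[of u "u+a" v "v+b"] ab B_meas
        by (simp add: nn_integral_cmult_indicator B_def mult.commute)
      also have "\<dots> \<le> (\<integral>\<^sup>+p. H x p \<partial>lborel)"
      proof (rule nn_integral_mono)
        fix p
        show "ennreal (\<phi> x) * indicator B p \<le> H x p"
        proof (cases "p \<in> B")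
          case True
          have "dist (\<phi> (F p)) (\<phi> x) < e"
            using r(2)[of x "F p"] near[OF True] xq F_cball[of p] B_Box True \<rho> by auto
          then have "\<phi> x \<le> \<phi> (F p) + e" by (simp add: dist_real_def)
          then show ?thesis using True B_Box near[OF True]
            by (auto simp: H_def intro!: ennreal_leI)
        qed simp
      qed
      finally show ?thesis .
    qed simp
    have H_meas: "case_prod H \<in> borel_measurable (lborel \<Otimes>\<^sub>M lborel)"
    proof -
      have [measurable]: "{z. dist (F (snd z)) (fst z) \<le> \<rho>} \<in> sets (borel \<Otimes>\<^sub>M borel)"
        unfolding borel_prod
        by (intro borel_closed closed_Collect_le continuous_intros continuous_on_compose2[OF cont_F]) auto
      have "(\<lambda>z. indicator {z. dist (F (snd z)) (fst z) \<le> \<rho>} z * (ennreal (\<phi> (F (snd z)) + e) * indicator Box (snd z)))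
         \<in> borel_measurable (borel \<Otimes>\<^sub>M borel)"
        by measurable
      also have "(\<lambda>z. indicator {z. dist (F (snd z)) (fst z) \<le> \<rho>} z * (ennreal (\<phi> (F (snd z)) + e) * indicator Box (snd z))) = case_prod H"
        by (auto simp: H_def fun_eq_iff split: split_indicator)
      finally show ?thesis by (simp cong: measurable_cong_sets)
    qed
    have "ennreal (a * b) * (\<integral>\<^sup>+x\<in>K. \<phi> x \<partial>lborel) = (\<integral>\<^sup>+x. ennreal (a * b) * (ennreal (\<phi> x) * indicator K x) \<partial>lborel)"
      by (rule nn_integral_cmult[symmetric]) measurable
    also have "\<dots> \<le> (\<integral>\<^sup>+x. \<integral>\<^sup>+p. H x p \<partial>lborel \<partial>lborel)"
      by (rule nn_integral_mono) (rule point)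
    also have "\<dots> = (\<integral>\<^sup>+p. \<integral>\<^sup>+x. H x p \<partial>lborel \<partial>lborel)"
      using H_meas by (rule lborel_pair.Fubini'[symmetric])
    also have "\<dots> = (\<integral>\<^sup>+p. ennreal (pi * \<rho>\<^sup>2) * (ennreal (\<phi> (F p) + e) * indicator Box p) \<partial>lborel)"
    proof (rule nn_integral_cong)
      fix p
      have [measurable]: "cball (F p) \<rho> \<in> sets borel" by (simp add: borel_closed)
      have "emeasure lborel (cball (F p) \<rho>) = ennreal (pi * \<rho>\<^sup>2)"
        using \<rho> by (simp add: emeasure_cball unit_ball_vol_2)
      then show "(\<integral>\<^sup>+x. H x p \<partial>lborel) = ennreal (pi * \<rho>\<^sup>2) * (ennreal (\<phi> (F p) + e) * indicator Box p)"
        unfolding H_def by (subst nn_integral_multc) (auto intro!: borel_measurable_indicator)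
    qed
    also have "\<dots> = ennreal (pi * \<rho>\<^sup>2) * (\<integral>\<^sup>+p. ennreal (\<phi> (F p)) * indicator Box p + ennreal e * indicator Box p \<partial>lborel)"
      using \<phi>(2) \<open>0 < e\<close> by (subst nn_integral_cmult) (auto simp: distrib_right)
    also have "(\<integral>\<^sup>+p. ennreal (\<phi> (F p)) * indicator Box p + ennreal e * indicator Box p \<partial>lborel) = J + ennreal (e * L)"
    proof -
      have "emeasure lborel Box = ennreal L"
        using emeasure_Times[of 0 L 0 1] pos by (simp add: Box_def)
      then show ?thesis using pos \<open>0 < e\<close>
        by (subst nn_integral_add) (auto simp: J_def nn_integral_cmult_indicator ennreal_mult)
    qed
    \<comment> \<open>The factor \<open>4 * D / \<rho>\<^sup>2\<close> is the reciprocal of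
      \<open>a * b\<close>; multiplied by the disc area it leaves \<open>4 * pi * D\<close>, free of
      \<open>\<rho>\<close>.\<close>
    finally have "ennreal (4 * D / \<rho>\<^sup>2) * (ennreal (a * b) * (\<integral>\<^sup>+x\<in>K. \<phi> x \<partial>lborel))
        \<le> ennreal (4 * D / \<rho>\<^sup>2) * (ennreal (pi * \<rho>\<^sup>2) * (J + ennreal (e * L)))"
      by (rule mult_left_mono) simp
    moreover have "ennreal (4 * D / \<rho>\<^sup>2) * (ennreal z * Z) = ennreal (4 * D / \<rho>\<^sup>2 * z) * Z" for z Z
      using pos by (subst ennreal_mult') (simp_all add: mult.assoc)
    moreover have "4 * D / \<rho>\<^sup>2 * (a * b) = 1" "4 * D / \<rho>\<^sup>2 * (pi * \<rho>\<^sup>2) = 4 * pi * D"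
      using \<rho> pos by (auto simp: a_def b_def power2_eq_square)
    ultimately have "(\<integral>\<^sup>+x\<in>K. \<phi> x \<partial>lborel) \<le> ennreal (4 * pi * D) * (J + ennreal (e * L))"
      by (simp only: ennreal_1 mult_1_left)
    also have "\<dots> = ennreal (4 * pi * D) * J + ennreal (4 * pi * D * (e * L))"
      using pos by (subst ennreal_mult') (simp_all add: distrib_left)
    also have "4 * pi * D * (e * L) = 4 * pi * D * L * e" by simp
    finally show ?thesis .
  qed
  note bound = this
  have "(\<integral>\<^sup>+x\<in>K. \<phi> x \<partial>lborel) \<le> ennreal (4 * pi * D) * J"
  proof (rule ennreal_le_epsilon)
    fix e :: real assume "0 < e"
    then show "(\<integral>\<^sup>+x\<in>K. \<phi> x \<partial>lborel) \<le> ennreal (4 * pi * D) * J + ennreal e"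
      using bound[of "e / (4 * pi * D * L)"] pos by simp
  qed
  then show ?thesis unfolding J_iter .
qed

section \<open>Moments about a fixed point of the body\<close>

text \<open>The ray from \<open>q\<close> through an interior point \<open>x\<close>, prolonged
  beyond \<open>x\<close>, must leave the bounded set \<open>K\<close>. If it hits the frontier at
  \<open>x + d *\<^sub>R (x - q)\<close>, then \<open>t = 1 / (1 + d)\<close>.\<close>

lemma compact_subset_frontier_cone:
  fixes K :: "'a::euclidean_space set"
  assumes "compact K" "q \<in> K" "x \<in> K"
  obtains y t where "y \<in> frontier K" "t \<in> {0..1}" "x = q + t *\<^sub>R (y - q)"
proof (cases "x \<in> frontier K")
  case True
  then show ?thesis using that[of x 1] by simp
next
  case False
  then have int: "x \<in> interior K" using assms by (simp add: frontier_def compact_imp_closed)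
  show ?thesis
  proof (cases "x = q")
    case True
    have "frontier K \<noteq> {}"
      using assms compact_imp_bounded by (metis empty_iff frontier_not_empty not_bounded_UNIV)
    then show ?thesis using that[of _ 0] True by fastforce
  next
    case False
    obtain d where d: "0 < d" "x + d *\<^sub>R (x - q) \<in> frontier K"
      using ray_to_frontier[OF compact_imp_bounded[OF \<open>compact K\<close>] int, of "x - q"] False by auto
    have "x = q + (1 / (1 + d)) *\<^sub>R ((1 + d) *\<^sub>R (x - q))"
      using d(1) by simp
    also have "(1 + d) *\<^sub>R (x - q) = x + d *\<^sub>R (x - q) - q" by (simp add: algebra_simps)
    finally show ?thesis using that[OF d(2), of "1 / (1 + d)"] d(1) by simp
  qed
qed

text \<open>The distance from \<open>q\<close> is homogeneous along rays, so the inner cone integral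
  separates and \<open>t powr n\<close> contributes the decisive factor
  \<open>1 / (n + 1)\<close>.\<close>

lemma nn_integral_dist_powr_le:
  fixes \<gamma> :: "real \<Rightarrow> real ^ 2"
  assumes \<gamma>: "1-lipschitz_on UNIV \<gamma>"
    and pos: "0 < L" "0 < D" "0 < n"
    and bnd: "\<And>s. dist (\<gamma> s) q \<le> D"
    and cone: "\<And>x. x \<in> K \<Longrightarrow> \<exists>s\<in>{0..L}. \<exists>t\<in>{0..1}. x = q + t *\<^sub>R (\<gamma> s - q)"
    and K: "K \<in> sets borel"
  shows "(\<integral>\<^sup>+x\<in>K. dist x q powr n \<partial>lborel) \<le>
    ennreal (4 * pi * D / (n + 1)) * (\<integral>\<^sup>+s\<in>{0..L}. dist (\<gamma> s) q powr n \<partial>lborel)"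
proof -
  have [measurable]: "\<gamma> \<in> borel_measurable borel"
    by (rule borel_measurable_continuous_onI[OF lipschitz_on_continuous_on[OF \<gamma>]])
  have "((\<lambda>t. t powr n) has_integral 1 / (n + 1)) {0..1::real}"
    using has_integral_powr_from_0[of n 1] pos by simp
  then have "((\<lambda>t. indicator {0..1} t * t powr n) has_integral 1 / (n + 1)) UNIV"
    unfolding has_integral_restrict_UNIV[where s = "{0..1}", symmetric]
    by (rule has_integral_eq[rotated]) auto
  then have "(\<integral>\<^sup>+t. ennreal (indicator {0..1} t * t powr n) \<partial>lborel) = ennreal (1 / (n + 1))"
    using nn_integral_has_integral_lborel[of "\<lambda>t. indicator {0..1} t * t powr n" "1 / (n + 1)"] by simp
  then have powr_int: "(\<integral>\<^sup>+t\<in>{0..1}. t powr n \<partial>lborel) = ennreal (1 / (n + 1))"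
    by (simp add: ennreal_mult'' ennreal_indicator mult.commute)
  have inner: "(\<integral>\<^sup>+t\<in>{0..1}. dist (q + t *\<^sub>R (\<gamma> s - q)) q powr n \<partial>lborel)
      = ennreal (1 / (n + 1)) * dist (\<gamma> s) q powr n" for s
  proof -
    have "(\<integral>\<^sup>+t\<in>{0..1}. dist (q + t *\<^sub>R (\<gamma> s - q)) q powr n \<partial>lborel)
      = (\<integral>\<^sup>+t. (ennreal (t powr n) * indicator {0..1} t) * ennreal (dist (\<gamma> s) q powr n) \<partial>lborel)"
      by (intro nn_integral_cong) (auto simp: dist_norm powr_mult ennreal_mult'' split: split_indicator)
    also have "\<dots> = ennreal (1 / (n + 1)) * dist (\<gamma> s) q powr n"
      by (subst nn_integral_multc) (auto simp: powr_int)
    finally show ?thesis .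
  qed
  have "continuous_on UNIV (\<lambda>x. dist x q powr n)"
    using pos by (intro continuous_on_powr' continuous_intros) auto
  then have "(\<integral>\<^sup>+x\<in>K. dist x q powr n \<partial>lborel) \<le> ennreal (4 * pi * D) *
      (\<integral>\<^sup>+s\<in>{0..L}. (\<integral>\<^sup>+t\<in>{0..1}. dist (q + t *\<^sub>R (\<gamma> s - q)) q powr n \<partial>lborel) \<partial>lborel)"
    using nn_integral_cone_le[OF \<gamma> pos(1,2) bnd cone K, of "\<lambda>x. dist x q powr n"] by simp
  also have "(\<integral>\<^sup>+s\<in>{0..L}. (\<integral>\<^sup>+t\<in>{0..1}. dist (q + t *\<^sub>R (\<gamma> s - q)) q powr n \<partial>lborel) \<partial>lborel)
      = ennreal (1 / (n + 1)) * (\<integral>\<^sup>+s\<in>{0..L}. dist (\<gamma> s) q powr n \<partial>lborel)"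
    unfolding inner mult.assoc by (rule nn_integral_cmult) measurable
  also have "ennreal (4 * pi * D) * (ennreal (1 / (n + 1)) * (\<integral>\<^sup>+s\<in>{0..L}. dist (\<gamma> s) q powr n \<partial>lborel))
      = ennreal (4 * pi * D / (n + 1)) * (\<integral>\<^sup>+s\<in>{0..L}. dist (\<gamma> s) q powr n \<partial>lborel)"
    using pos by (simp add: mult.assoc[symmetric] ennreal_mult'[symmetric])
  finally show ?thesis .
qed

text \<open>Pulls expectations on the curve back to the parameter interval; the total mass is
  \<open>L\<close> because \<open>g\<close> maps \<open>{0..L}\<close> onto
  \<open>S\<close>.\<close>

lemma nn_integral_uniform_on_curve:
  fixes f :: "'a::metric_space \<Rightarrow> ennreal"
  assumes g: "arc_length_parametrization g L S" and S: "S \<in> sets borel"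
    and f: "f \<in> borel_measurable borel"
  shows "(\<integral>\<^sup>+y. f y \<partial>uniform_measure (distr (lebesgue_on {0..L}) borel g) S)
    = (\<integral>\<^sup>+s\<in>{0..L}. f (g s) \<partial>lborel) / ennreal L"
proof -
  have L: "0 < L" and cont: "continuous_on {0..L} g" and img: "g ` {0..L} = S"
    using g by (auto simp: arc_length_parametrization_def)
  have g_meas: "g \<in> measurable (lebesgue_on {0..L}) borel"
    using cont by (rule continuous_imp_measurable_on_sets_lebesgue) simp
  have "emeasure (distr (lebesgue_on {0..L}) borel g) S = emeasure (lebesgue_on {0..L}) {0..L}"
    using img S g_meas by (subst emeasure_distr) (auto intro!: arg_cong2[where f = emeasure])
  also have "\<dots> = ennreal L" using L by (simp add: emeasure_restrict_space)
  finally have "emeasure (distr (lebesgue_on {0..L}) borel g) S = ennreal L" .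
  moreover have "(\<integral>\<^sup>+y. f y * indicator S y \<partial>distr (lebesgue_on {0..L}) borel g)
      = (\<integral>\<^sup>+s. f (g s) * indicator S (g s) * indicator {0..L} s \<partial>lebesgue)"
    using f S g_meas by (subst nn_integral_distr) (auto simp: nn_integral_restrict_space)
  moreover have "\<dots> = (\<integral>\<^sup>+s\<in>{0..L}. f (g s) \<partial>lborel)"
    unfolding nn_integral_completion using img
    by (intro nn_integral_cong) (auto split: split_indicator)
  ultimately show ?thesis using f S by (subst nn_integral_uniform_measure) auto
qed

text \<open>With \<open>A\<close> the area, the cone estimate carries the factor
  \<open>4 * pi * D / ((n + 1) * A)\<close>. The lower bound on \<open>n\<close> makes it at most
  \<open>1 / L\<close>, the normalization on the frontier.\<close>

lemma moment_uniform_le_moment_frontier: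
  fixes K :: "(real ^ 2) set"
  assumes K: "convex_body K" and q: "q \<in> K"
    and g: "arc_length_parametrization g L (frontier K)"
    and n: "0 < n" "4 * pi * (diameter K + 1) * L / measure lborel K \<le> n"
  shows "(\<integral>\<^sup>+x. dist x q powr n \<partial>uniform_measure lborel K)
    \<le> (\<integral>\<^sup>+y. dist y q powr n \<partial>uniform_measure (distr (lebesgue_on {0..L}) borel g) (frontier K))"
proof -
  define D where "D = diameter K + 1"
  define A where "A = measure lborel K"
  \<comment> \<open>Constant continuation beyond both ends keeps the curve on the frontier and makes
    it 1-Lipschitz on the whole line.\<close>
  define \<gamma> where "\<gamma> = (\<lambda>s. g (max 0 (min L s)))"
  have K': "convex K" "compact K" "interior K \<noteq> {}" using K by (auto simp: convex_body_def)
  have L: "0 < L" and img: "g ` {0..L} = frontier K"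
    using g by (auto simp: arc_length_parametrization_def)
  have \<gamma>_eq: "\<gamma> s = g s" if "s \<in> {0..L}" for s using that by (simp add: \<gamma>_def)
  have lip: "1-lipschitz_on UNIV \<gamma>"
  proof (rule lipschitz_onI)
    fix s t
    have "dist (\<gamma> s) (\<gamma> t) \<le> \<bar>max 0 (min L s) - max 0 (min L t)\<bar>"
      unfolding \<gamma>_def by (rule arc_length_parametrization_dist_le[OF g]) (use L in auto)
    also have "\<dots> \<le> \<bar>s - t\<bar>" by (auto simp: max_def min_def)
    finally show "dist (\<gamma> s) (\<gamma> t) \<le> 1 * dist s t" by (simp add: dist_real_def)
  qed simp
  have diam: "dist x y \<le> D" if "x \<in> K" "y \<in> K" for x y
    using diameter_bounded_bound[OF compact_imp_bounded[OF K'(2)] that] by (simp add: D_def)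
  have fr: "frontier K \<subseteq> K" by (simp add: K'(2) compact_imp_closed frontier_subset_closed)
  have bnd: "dist (\<gamma> s) q \<le> D" for s
    using img fr L q by (intro diam) (auto simp: \<gamma>_def)
  have D: "0 < D" using diameter_ge_0[OF compact_imp_bounded[OF K'(2)]] by (simp add: D_def)
  have fin: "emeasure lborel K = ennreal A"
    using emeasure_bounded_finite[OF compact_imp_bounded[OF K'(2)]]
    by (simp add: A_def emeasure_eq_ennreal_measure)
  have A: "0 < A"
  proof -
    \<comment> \<open>A convex null set has empty interior.\<close>
    have "A \<noteq> 0"
      using K' negligible_convex_interior[OF K'(1)] fin
      by (auto simp: negligible_iff_emeasure0 borel_compact)
    then show ?thesis by (simp add: A_def zero_less_measure_iff)
  qed
  have cone: "\<exists>s\<in>{0..L}. \<exists>t\<in>{0..1}. x = q + t *\<^sub>R (\<gamma> s - q)" if x: "x \<in> K" for x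
  proof -
    obtain y t where yt: "y \<in> frontier K" "t \<in> {0..1}" "x = q + t *\<^sub>R (y - q)"
      using compact_subset_frontier_cone[OF K'(2) q x] .
    then obtain s where "s \<in> {0..L}" "y = g s" using img by (metis imageE)
    then show ?thesis using yt \<gamma>_eq by (intro bexI[of _ s] bexI[of _ t]) auto
  qed
  have K_meas: "K \<in> sets borel" using K'(2) by (rule borel_compact)
  define I where "I = (\<integral>\<^sup>+s\<in>{0..L}. dist (\<gamma> s) q powr n \<partial>lborel)"
  have "(\<integral>\<^sup>+x. dist x q powr n \<partial>uniform_measure lborel K) = (\<integral>\<^sup>+x\<in>K. dist x q powr n \<partial>lborel) / ennreal A"
    using K_meas by (subst nn_integral_uniform_measure) (auto simp: fin)
  also have "\<dots> \<le> (ennreal (4 * pi * D / (n + 1)) * I) / ennreal A"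
    unfolding I_def by (intro divide_right_mono_ennreal nn_integral_dist_powr_le[OF lip L D n(1) bnd cone K_meas])
  also have "\<dots> = ennreal (4 * pi * D / (n + 1) / A) * I"
    using A D n by (simp add: divide_ennreal_def inverse_ennreal ennreal_mult divide_inverse mult_ac)
  also have "\<dots> \<le> ennreal (1 / L) * I"
  proof (intro mult_right_mono ennreal_leI)
    have "4 * pi * D * L \<le> n * A" using n(2) A by (simp add: D_def A_def field_simps)
    also have "\<dots> \<le> (n + 1) * A" using A by simp
    finally have "4 * pi * D * L \<le> (n + 1) * A" .
    moreover have "0 < (n + 1) * A" using A n(1) by simp
    ultimately show "4 * pi * D / (n + 1) / A \<le> 1 / L"
      using L by (simp add: pos_le_divide_eq pos_divide_le_eq)
  qed simp
  also have "\<dots> = I / ennreal L"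
    using L by (simp add: divide_ennreal_def inverse_ennreal divide_inverse mult.commute)
  also have "I = (\<integral>\<^sup>+s\<in>{0..L}. dist (g s) q powr n \<partial>lborel)"
    unfolding I_def using \<gamma>_eq by (intro nn_integral_cong) (auto split: split_indicator)
  also have "\<dots> / ennreal L = (\<integral>\<^sup>+y. dist y q powr n \<partial>uniform_measure (distr (lebesgue_on {0..L}) borel g) (frontier K))"
    by (subst nn_integral_uniform_on_curve[OF g]) auto
  finally show ?thesis .
qed

section \<open>Independent variables and their laws\<close>

lemma (in prob_space) indep_vars_imp_indep_var:
  assumes ind: "indep_vars (\<lambda>_. N) X I" and ij: "i \<in> I" "j \<in> I" "i \<noteq> j"
  shows "indep_var N (X i) N (X j)"
proof -
  have "indep_var N ((\<lambda>f. f i) \<circ> (\<lambda>\<omega>. restrict (\<lambda>i. X i \<omega>) {i})) N ((\<lambda>f. f j) \<circ> (\<lambda>\<omega>. restrict (\<lambda>i. X i \<omega>) {j}))"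
    using indep_var_restrict[OF ind, of "{i}" "{j}"] ij
    by (intro indep_var_compose[of "Pi\<^sub>M {i} (\<lambda>_. N)" _ "Pi\<^sub>M {j} (\<lambda>_. N)"]) auto
  then show ?thesis by (simp add: comp_def)
qed

text \<open>The joint law of independent variables is the product of their laws, so Tonelli applies;
  this allows conditioning on \<open>X\<close>.\<close>

lemma (in prob_space) nn_integral_indep_var:
  fixes X Y :: "'a \<Rightarrow> 'b::second_countable_topology"
  assumes ind: "indep_var borel X borel Y"
    and h: "case_prod h \<in> borel_measurable (borel \<Otimes>\<^sub>M borel)"
  shows "(\<integral>\<^sup>+\<omega>. h (X \<omega>) (Y \<omega>) \<partial>M) = (\<integral>\<^sup>+x. \<integral>\<^sup>+y. h x y \<partial>distr M borel Y \<partial>distr M borel X)"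
proof -
  have [measurable]: "X \<in> borel_measurable M" "Y \<in> borel_measurable M"
    and eq: "distr M borel X \<Otimes>\<^sub>M distr M borel Y = distr M (borel \<Otimes>\<^sub>M borel) (\<lambda>\<omega>. (X \<omega>, Y \<omega>))"
    using ind by (auto simp: indep_var_distribution_eq)
  interpret Y: prob_space "distr M borel Y" by (rule prob_space_distr) simp
  have h': "case_prod h \<in> borel_measurable (distr M borel X \<Otimes>\<^sub>M distr M borel Y)"
    using h by (simp cong: measurable_cong_sets)
  have "(\<integral>\<^sup>+\<omega>. h (X \<omega>) (Y \<omega>) \<partial>M) = (\<integral>\<^sup>+z. case_prod h z \<partial>distr M (borel \<Otimes>\<^sub>M borel) (\<lambda>\<omega>. (X \<omega>, Y \<omega>)))"
    using h by (subst nn_integral_distr) auto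
  also have "\<dots> = (\<integral>\<^sup>+x. \<integral>\<^sup>+y. h x y \<partial>distr M borel Y \<partial>distr M borel X)"
    unfolding eq[symmetric] using Y.nn_integral_fst[OF h'] by simp
  finally show ?thesis .
qed

lemma AE_in_of_distr_uniform:
  assumes "X \<in> borel_measurable M" "distr M borel X = uniform_measure \<mu> S"
    and "S \<in> sets \<mu>" "S \<in> sets borel"
  shows "AE \<omega> in M. X \<omega> \<in> S"
proof -
  have "AE x in distr M borel X. x \<in> S"
    unfolding assms(2) using assms(3) by (intro AE_uniform_measureI) auto
  then show ?thesis using assms(1,4) by (subst (asm) AE_distr_iff) auto
qed

section \<open>The two moment inequalities\<close>

theorem corollary3:
  fixes K :: "(real ^ 2) set"
  assumes "convex_body K"
  shows "\<exists>C>0. \<forall>n::real. n > C \<longrightarrow>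
    (\<forall>(M :: 's measure) X X' Y Y'.
       prob_space M \<and>
       uniform_in M K X \<and> uniform_in M K X' \<and>
       uniform_on_curve M (frontier K) Y \<and> uniform_on_curve M (frontier K) Y' \<and>
       prob_space.indep_vars M (\<lambda>_. borel) (\<lambda>i. [X, X', Y, Y'] ! i) {..<4} \<longrightarrow>
       (LINT \<omega>|M. dist (X \<omega>) (X' \<omega>) powr n) \<le> (LINT \<omega>|M. dist (X \<omega>) (Y \<omega>) powr n) \<and>
       (LINT \<omega>|M. dist (X \<omega>) (Y \<omega>) powr n) \<le> (LINT \<omega>|M. dist (Y \<omega>) (Y' \<omega>) powr n))"
proof -
  have K: "convex K" "compact K" "interior K \<noteq> {}" using assms by (auto simp: convex_body_def)
  have K_meas: "K \<in> sets borel" "frontier K \<in> sets borel"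
    using K by (auto intro: borel_compact borel_closed)
  have fr: "frontier K \<subseteq> K" by (simp add: K(2) compact_imp_closed frontier_subset_closed)
  have diam: "dist x y \<le> diameter K" if "x \<in> K" "y \<in> K" for x y
    using diameter_bounded_bound[OF compact_imp_bounded[OF K(2)] that] .
  obtain c where "c \<in> interior K" using K(3) by blast
  then obtain r where r: "0 < r" "ball c r \<subseteq> K" using mem_interior by blast
  then have "c \<in> K" by auto
  then have "K \<subseteq> cball c (diameter K)" using diam by auto
  define B where "B = (diameter K + (diameter K)\<^sup>2 / r) * (2 * pi)"
  have B: "L \<le> B" if "arc_length_parametrization g L (frontier K)" for g L
    unfolding B_def
    by (rule arc_length_frontier_bound[OF K(1) compact_imp_closed[OF K(2)] r(2,1) \<open>K \<subseteq> cball c (diameter K)\<close> that])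
  \<comment> \<open>The second entry is the threshold of the fixed-point comparison with
    \<open>L\<close> replaced by its bound \<open>B\<close>; the entry 1 secures positivity.\<close>
  define C where "C = max 1 (4 * pi * (diameter K + 1) * B / measure lborel K)"
  have "0 < C" by (simp add: C_def)
  moreover have "(LINT \<omega>|M. dist (X \<omega>) (X' \<omega>) powr n) \<le> (LINT \<omega>|M. dist (X \<omega>) (Y \<omega>) powr n) \<and>
       (LINT \<omega>|M. dist (X \<omega>) (Y \<omega>) powr n) \<le> (LINT \<omega>|M. dist (Y \<omega>) (Y' \<omega>) powr n)"
    if n: "n > C" and M: "prob_space M"
      and X: "uniform_in M K X" and X': "uniform_in M K X'"
      and Y: "uniform_on_curve M (frontier K) Y" and Y': "uniform_on_curve M (frontier K) Y'"
      and ind: "prob_space.indep_vars M (\<lambda>_. borel) (\<lambda>i. [X, X', Y, Y'] ! i) {..<4}"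
    for n and M :: "'s measure" and X X' Y Y'
  proof -
    interpret prob_space M by (rule M)
    have [measurable]: "X \<in> borel_measurable M" "X' \<in> borel_measurable M"
      "Y \<in> borel_measurable M" "Y' \<in> borel_measurable M"
      using X X' Y Y' by (auto simp: uniform_in_def uniform_on_curve_def)
    have dX: "distr M borel X = uniform_measure lborel K" "distr M borel X' = uniform_measure lborel K"
      using X X' by (auto simp: uniform_in_def)
    have n_bound: "0 < n" "4 * pi * (diameter K + 1) * L / measure lborel K \<le> n"
      if "arc_length_parametrization g L (frontier K)" for g L
    proof -
      show "0 < n" using n \<open>0 < C\<close> by simp
      have "4 * pi * (diameter K + 1) * L / measure lborel K \<le> 4 * pi * (diameter K + 1) * B / measure lborel K"
        using B[OF that] diameter_ge_0[OF compact_imp_bounded[OF K(2)]]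
        by (intro divide_right_mono mult_left_mono) auto
      also have "\<dots> \<le> n" using n by (simp add: C_def)
      finally show "4 * pi * (diameter K + 1) * L / measure lborel K \<le> n" .
    qed
    have curve: "(\<integral>\<^sup>+x. dist x q powr n \<partial>uniform_measure lborel K) \<le> (\<integral>\<^sup>+y. dist y q powr n \<partial>distr M borel Z)"
      "AE \<omega> in M. Z \<omega> \<in> frontier K"
      if Z: "uniform_on_curve M (frontier K) Z" and q: "q \<in> K" for Z q
    proof -
      obtain g L where g: "arc_length_parametrization g L (frontier K)"
        "distr M borel Z = uniform_measure (distr (lebesgue_on {0..L}) borel g) (frontier K)"
        and "Z \<in> borel_measurable M"
        using Z by (auto simp: uniform_on_curve_def arc_length_measure_on_def)
      then show "AE \<omega> in M. Z \<omega> \<in> frontier K"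
        using K_meas by (intro AE_in_of_distr_uniform) auto
      show "(\<integral>\<^sup>+x. dist x q powr n \<partial>uniform_measure lborel K) \<le> (\<integral>\<^sup>+y. dist y q powr n \<partial>distr M borel Z)"
        unfolding g(2) by (rule moment_uniform_le_moment_frontier[OF assms q g(1) n_bound[OF g(1)]])
    qed
    \<comment> \<open>The second fact of \<open>curve\<close> is stated for some \<open>q\<close> in
      \<open>K\<close>; the centre \<open>c\<close> serves.\<close>
    have in_K: "AE \<omega> in M. X \<omega> \<in> K" "AE \<omega> in M. Y \<omega> \<in> K" "AE \<omega> in M. Y' \<omega> \<in> K"
      using AE_in_of_distr_uniform[OF _ dX(1)] K_meas curve(2)[OF Y \<open>c \<in> K\<close>] curve(2)[OF Y' \<open>c \<in> K\<close>] fr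
      by auto
    have dist_meas: "(\<lambda>(x, y). ennreal (dist x y powr n)) \<in> borel_measurable (borel \<Otimes>\<^sub>M (borel :: (real^2) measure))"
      by measurable
    have pair: "(\<integral>\<^sup>+\<omega>. dist (U \<omega>) (V \<omega>) powr n \<partial>M)
        = (\<integral>\<^sup>+q. \<integral>\<^sup>+x. dist x q powr n \<partial>distr M borel V \<partial>distr M borel U)"
      if "indep_var borel U borel V" for U V :: "'s \<Rightarrow> real^2"
      by (subst nn_integral_indep_var[OF that dist_meas]) (simp add: dist_commute)
    have iv: "indep_var borel ([X, X', Y, Y'] ! i) borel ([X, X', Y, Y'] ! j)"
      if "i < 4" "j < 4" "i \<noteq> j" for i j
      using indep_vars_imp_indep_var[OF ind] that by auto
    have iv: "indep_var borel X borel X'" "indep_var borel X borel Y"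
      "indep_var borel Y borel X" "indep_var borel Y borel Y'"
      using iv[of 0 1] iv[of 0 2] iv[of 2 0] iv[of 2 3] by auto
    \<comment> \<open>Given \<open>U = q\<close> in \<open>K\<close>, the fixed-point comparison
      applies to \<open>V\<close> and \<open>Z\<close>; integrating over the law of \<open>U\<close>
      keeps the inequality. \<open>U\<close> will be \<open>X\<close> for the first inequality and
      \<open>Y\<close> for the second.\<close>
    have nn_mono: "(\<integral>\<^sup>+\<omega>. dist (U \<omega>) (V \<omega>) powr n \<partial>M) \<le> (\<integral>\<^sup>+\<omega>. dist (U \<omega>) (Z \<omega>) powr n \<partial>M)"
      if "indep_var borel U borel V" "indep_var borel U borel Z" "AE \<omega> in M. U \<omega> \<in> K"
        "distr M borel V = uniform_measure lborel K" "uniform_on_curve M (frontier K) Z" for U V Z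
    proof -
      have U: "U \<in> borel_measurable M" using that(1) by (rule indep_var_rv1)
      then have "AE q in distr M borel U. q \<in> K"
        using that(3) K_meas by (subst AE_distr_iff) auto
      then show ?thesis
        unfolding pair[OF that(1)] pair[OF that(2)] that(4)
        by (intro nn_integral_mono_AE) (auto elim!: eventually_mono intro: curve(1)[OF that(5)])
    qed
    \<comment> \<open>The Lebesgue integral of a non-integrable function is 0 by convention, so the
      larger side must be finite: almost surely its integrand is at most
      \<open>diameter K powr n\<close>.\<close>
    have lint_mono: "(LINT \<omega>|M. dist (U \<omega>) (V \<omega>) powr n) \<le> (LINT \<omega>|M. dist (W \<omega>) (Z \<omega>) powr n)"
      if le: "(\<integral>\<^sup>+\<omega>. dist (U \<omega>) (V \<omega>) powr n \<partial>M) \<le> (\<integral>\<^sup>+\<omega>. dist (W \<omega>) (Z \<omega>) powr n \<partial>M)"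
        and WZ: "AE \<omega> in M. W \<omega> \<in> K" "AE \<omega> in M. Z \<omega> \<in> K"
        and [measurable]: "U \<in> borel_measurable M" "V \<in> borel_measurable M"
          "W \<in> borel_measurable M" "Z \<in> borel_measurable M"
      for U V W Z :: "'s \<Rightarrow> real^2"
    proof -
      have "(\<integral>\<^sup>+\<omega>. dist (W \<omega>) (Z \<omega>) powr n \<partial>M) \<le> (\<integral>\<^sup>+\<omega>. ennreal (diameter K powr n) \<partial>M)"
        using WZ n \<open>0 < C\<close>
        by (intro nn_integral_mono_AE) (auto intro!: ennreal_leI powr_mono2 diam)
      also have "\<dots> < \<top>" by (simp add: emeasure_space_1)
      finally show ?thesis
        using le by (simp add: integral_eq_nn_integral enn2real_mono)
    qed
    have "(\<integral>\<^sup>+\<omega>. dist (X \<omega>) (X' \<omega>) powr n \<partial>M) \<le> (\<integral>\<^sup>+\<omega>. dist (X \<omega>) (Y \<omega>) powr n \<partial>M)"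
      using iv in_K dX Y by (intro nn_mono)
    moreover have "(\<integral>\<^sup>+\<omega>. dist (X \<omega>) (Y \<omega>) powr n \<partial>M) \<le> (\<integral>\<^sup>+\<omega>. dist (Y \<omega>) (Y' \<omega>) powr n \<partial>M)"
      using nn_mono[OF iv(3,4) in_K(2) dX(1) Y'] by (simp add: dist_commute)
    ultimately show ?thesis using in_K by (auto intro!: lint_mono)
  qed
  ultimately show ?thesis by blast
qed

end
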